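(* Let $C\subseteq\mathbb{R}^n$ be a convex set and let $f:C\to\mathbb{R}$ be continuously differentiable. Let $\bar x\in C$ be such that $T_C(\bar x)$ is polyhedral. Let $\Gamma(\bar x)$ be a set of feasible search paths at $\bar x$ such that $\operatorname{cone}(D)=T_C(\bar x)$, where $D=\{\gamma'(0)\mid\gamma\in\Gamma(\bar x)\}$. Assume further that there exists $\epsilon>0$ such that $f(\gamma(t))\ge f(\gamma(0))=f(\bar x)$ for all $t\in(0,\epsilon)$ and all $\gamma\in\Gamma(\bar x)$. Then $\bar x$ is a stationary point of $\min_{x\in C}f(x)$, i.e. $\nabla f(\bar x)^Td\ge 0$ for all $d\in T_C(\bar x)$.
   Context: Continuous differentiability of $f:C\to\mathbb{R}$ means that there is a continuous map $\nabla f:C\to\mathbb{R}^n$ with $f(y)=f(x)+\nabla f(x)^T(y-x)+o(\|y-x\|)$ as $y\to x$, $y\in C$, for each $x\in C$. Tangent cone. For $x\in C$, $T_C(x)=\{0\}\cup\{y\in\mathbb{R}^n\setminus\{0\}\mid \exists\{x^k\}\subseteq C\setminus\{x\}\text{ with }x^k\to x\text{ and }\frac{x^k-x}{\|x^k-x\|}\to\frac{y}{\|y\|}\}$. For a set of directions $D\subseteq\mathbb{R}^n$, $\operatorname{cone}(D)$ is the set of all finite linear combinations of elements of $D$ with nonnegative coefficients. Feasible search path at $x\in C$: a continuous curve $\gamma:\mathbb{R}_+\to C$ ($\mathbb{R}_+=[0,\infty)$) with $\gamma(0)=x$ that is (one-sidedly) differentiable at $t=0$, with derivative (initial velocity) $\gamma'(0)$.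 *)

theory Defs
  imports "HOL-Analysis.Analysis"
begin

text \<open>
  \<open>g\<close> plays the role of \<open>\<nabla>f : C \<rightarrow> \<real>\<^sup>n\<close>. The derivative is taken within \<open>C\<close>, so \<open>C\<close> need not be open
  (nor full-dimensional) and only the values of \<open>f\<close> and \<open>g\<close> on \<open>C\<close> matter; in particular \<open>g\<close> need
  not be unique.
\<close>

definition continuous_gradient_on ::
    "(real ^ 'n) set \<Rightarrow> (real ^ 'n \<Rightarrow> real) \<Rightarrow> (real ^ 'n \<Rightarrow> real ^ 'n) \<Rightarrow> bool" where
  "continuous_gradient_on C f g \<longleftrightarrow>
     continuous_on C g \<and>
     (\<forall>x\<in>C. (f has_derivative (\<lambda>h. g x \<bullet> h)) (at x within C))"

definition tangent_cone :: "(real ^ 'n) set \<Rightarrow> real ^ 'n \<Rightarrow> (real ^ 'n) set" where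
  "tangent_cone C x =
     {0} \<union> {y. y \<noteq> 0 \<and>
       (\<exists>X :: nat \<Rightarrow> real ^ 'n.
          (\<forall>k. X k \<in> C - {x}) \<and>
          X \<longlonglongrightarrow> x \<and>
          (\<lambda>k. (X k - x) /\<^sub>R norm (X k - x)) \<longlonglongrightarrow> y /\<^sub>R norm y)}"

text \<open>The empty combination is allowed, so the cone generated by the empty set is \<open>{0}\<close>.\<close>

definition generated_cone :: "(real ^ 'n) set \<Rightarrow> (real ^ 'n) set" where
  "generated_cone D =
     {(\<Sum>v\<in>S. c v *\<^sub>R v) | S c. finite S \<and> S \<subseteq> D \<and> (\<forall>v\<in>S. 0 \<le> c v)}"

lemma generated_cone_eq_convex_cone_hull: "generated_cone D = convex_cone hull D"
proof (rule antisym)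
  show "generated_cone D \<subseteq> convex_cone hull D"
  proof
    fix x assume "x \<in> generated_cone D"
    then obtain S c where S: "finite S" "S \<subseteq> D" "\<forall>v\<in>S. 0 \<le> c v" and x: "x = (\<Sum>v\<in>S. c v *\<^sub>R v)"
      by (auto simp: generated_cone_def)
    from S have "(\<Sum>v\<in>S. c v *\<^sub>R v) \<in> convex_cone hull D"
      by (induction S rule: finite_induct)
        (auto simp: convex_cone_hull_contains_0 intro!: convex_cone_hull_add convex_cone_hull_mul
          intro: hull_inc)
    then show "x \<in> convex_cone hull D" by (simp add: x)
  qed
next
  have "convex_cone (generated_cone D)"
    unfolding convex_cone_iff
  proof (intro conjI ballI allI impI)
    show "0 \<in> generated_cone D"
      unfolding generated_cone_def by (force intro: exI[of _ "{}"])
  next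
    fix x y assume "x \<in> generated_cone D" "y \<in> generated_cone D"
    then obtain S c T d where S: "finite S" "S \<subseteq> D" "\<forall>v\<in>S. 0 \<le> c v" "x = (\<Sum>v\<in>S. c v *\<^sub>R v)"
      and T: "finite T" "T \<subseteq> D" "\<forall>v\<in>T. 0 \<le> d v" "y = (\<Sum>v\<in>T. d v *\<^sub>R v)"
      unfolding generated_cone_def by blast
    define e where "e v = (if v \<in> S then c v else 0) + (if v \<in> T then d v else 0)" for v
    have "x = (\<Sum>v\<in>S \<union> T. (if v \<in> S then c v else 0) *\<^sub>R v)"
      unfolding S(4) using S(1) T(1) by (intro sum.mono_neutral_cong_left) auto
    moreover have "y = (\<Sum>v\<in>S \<union> T. (if v \<in> T then d v else 0) *\<^sub>R v)"
      unfolding T(4) using S(1) T(1) by (intro sum.mono_neutral_cong_left) auto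
    ultimately have "x + y = (\<Sum>v\<in>S \<union> T. e v *\<^sub>R v)"
      by (simp add: e_def scaleR_add_left sum.distrib)
    moreover have "finite (S \<union> T)" "S \<union> T \<subseteq> D" "\<forall>v\<in>S \<union> T. 0 \<le> e v"
      using S T by (auto simp: e_def)
    ultimately show "x + y \<in> generated_cone D"
      unfolding generated_cone_def by blast
  next
    fix x and r :: real assume "x \<in> generated_cone D" and r: "0 \<le> r"
    then obtain S c where S: "finite S" "S \<subseteq> D" "\<forall>v\<in>S. 0 \<le> c v" "x = (\<Sum>v\<in>S. c v *\<^sub>R v)"
      unfolding generated_cone_def by blast
    have "r *\<^sub>R x = (\<Sum>v\<in>S. (r * c v) *\<^sub>R v)" "\<forall>v\<in>S. 0 \<le> r * c v"
      using S r by (auto simp: scaleR_sum_right)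
    then show "r *\<^sub>R x \<in> generated_cone D"
      using S unfolding generated_cone_def
      by (intro CollectI exI[of _ S] exI[of _ "\<lambda>v. r * c v"]) auto
  qed
  moreover have "D \<subseteq> generated_cone D"
  proof
    fix v assume "v \<in> D"
    then show "v \<in> generated_cone D"
      unfolding generated_cone_def
      by (intro CollectI exI[of _ "{v}"] exI[of _ "\<lambda>_. 1"]) auto
  qed
  ultimately show "convex_cone hull D \<subseteq> generated_cone D"
    by (intro hull_minimal)
qed

text \<open>Curves are total functions on the reals, of which only the restriction to \<open>{0..}\<close> matters.\<close>

definition feasible_search_path ::
    "(real ^ 'n) set \<Rightarrow> real ^ 'n \<Rightarrow> (real \<Rightarrow> real ^ 'n) \<Rightarrow> bool" where
  "feasible_search_path C x \<gamma> \<longleftrightarrow>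
     continuous_on {0..} \<gamma> \<and> \<gamma> ` {0..} \<subseteq> C \<and> \<gamma> 0 = x \<and>
     \<gamma> differentiable (at 0 within {0..})"

definition initial_velocity :: "(real \<Rightarrow> real ^ 'n) \<Rightarrow> real ^ 'n" where
  "initial_velocity \<gamma> = vector_derivative \<gamma> (at 0 within {0..})"

end

theory Submission
  imports Defs
begin

text \<open>
  Along each search path the directional derivative of \<open>f\<close> in the initial velocity is nonnegative,
  because \<open>f \<circ> \<gamma>\<close> has a one-sided local minimum at \<open>0\<close>; nonnegative combinations inherit the sign.
\<close>

lemma inner_gradient_initial_velocity_nonneg:
  assumes f: "(f has_derivative (\<lambda>h. g \<bullet> h)) (at x within C)"
    and \<gamma>: "feasible_search_path C x \<gamma>"
    and \<epsilon>: "0 < \<epsilon>" "\<And>t. 0 < t \<Longrightarrow> t < \<epsilon> \<Longrightarrow> f (\<gamma> 0) \<le> f (\<gamma> t)"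
  shows "0 \<le> g \<bullet> initial_velocity \<gamma>"
proof (rule ccontr)
  assume neg: "\<not> 0 \<le> g \<bullet> initial_velocity \<gamma>"
  \<comment> \<open>\<open>vector_derivative\<close> picks its value by choice; one-sided
    differentiability of the path at 0 makes that value a genuine derivative.\<close>
  have \<gamma>': "(\<gamma> has_derivative (\<lambda>t. t *\<^sub>R initial_velocity \<gamma>)) (at 0 within {0..})"
    using \<gamma> unfolding feasible_search_path_def initial_velocity_def
    by (metis vector_derivative_works has_vector_derivative_def)
  \<comment> \<open>The chain rule asks for the derivative of \<open>f\<close> within the image of
    the path. Since the path stays in \<open>C\<close>, restricting the derivative within
    \<open>C\<close> suffices.\<close>
  have "(f has_derivative (\<lambda>h. g \<bullet> h)) (at (\<gamma> 0) within \<gamma> ` {0..})"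
    using f \<gamma> unfolding feasible_search_path_def by (metis has_derivative_subset)
  from diff_chain_within[OF \<gamma>' this]
  have "((f \<circ> \<gamma>) has_real_derivative g \<bullet> initial_velocity \<gamma>) (at 0 within {0..})"
    by (simp add: has_field_derivative_def o_def mult.commute mult_commute_abs)
  \<comment> \<open>A negative right derivative forces values strictly below
    \<open>f (\<gamma> 0)\<close> just after time 0.\<close>
  from has_real_derivative_neg_dec_right[OF this] neg obtain \<delta> where
    \<delta>: "0 < \<delta>" "\<And>h. 0 < h \<Longrightarrow> h < \<delta> \<Longrightarrow> f (\<gamma> h) < f (\<gamma> 0)"
    by auto
  \<comment> \<open>A time at which both the strict decrease and the assumed lower bound
    apply.\<close>
  define t where "t = min \<delta> \<epsilon> / 2"
  have "0 < t" "t < \<delta>" "t < \<epsilon>"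
    using \<delta>(1) \<epsilon>(1) by (auto simp: t_def)
  with \<delta>(2)[of t] \<epsilon>(2)[of t] show False by simp
qed

text \<open>By linearity \<open>g \<bullet> d\<close> is a sum of terms
  \<open>c v * (g \<bullet> v)\<close>, each nonnegative: the vectors with nonnegative inner product
  with \<open>g\<close> form a convex cone.\<close>

lemma inner_generated_cone_nonneg:
  assumes "\<And>v. v \<in> D \<Longrightarrow> 0 \<le> g \<bullet> v" and "d \<in> generated_cone D"
  shows "0 \<le> g \<bullet> d"
proof -
  obtain S c where "S \<subseteq> D" "\<forall>v\<in>S. 0 \<le> c v" "d = (\<Sum>v\<in>S. c v *\<^sub>R v)"
    using assms(2) unfolding generated_cone_def by blast
  with assms(1) show ?thesis
    by (force simp: inner_sum_right intro!: sum_nonneg mult_nonneg_nonneg)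
qed

theorem proposition3p3:
  fixes C :: "(real ^ 'n) set"
    and f :: "real ^ 'n \<Rightarrow> real"
    and grad_f :: "real ^ 'n \<Rightarrow> real ^ 'n"
    and xbar :: "real ^ 'n"
    and \<Gamma> :: "(real \<Rightarrow> real ^ 'n) set"
  assumes "convex C"
    and "continuous_gradient_on C f grad_f"
    and "xbar \<in> C"
    and "polyhedron (tangent_cone C xbar)"
    and "\<forall>\<gamma>\<in>\<Gamma>. feasible_search_path C xbar \<gamma>"
    and "generated_cone {initial_velocity \<gamma> | \<gamma>. \<gamma> \<in> \<Gamma>} = tangent_cone C xbar"
    and "\<exists>\<epsilon>>0. \<forall>t\<in>{0<..<\<epsilon>}. \<forall>\<gamma>\<in>\<Gamma>. f (\<gamma> t) \<ge> f (\<gamma> 0)"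
  shows "\<forall>d\<in>tangent_cone C xbar. grad_f xbar \<bullet> d \<ge> 0"
proof
  fix d assume "d \<in> tangent_cone C xbar"
  moreover have "0 \<le> grad_f xbar \<bullet> initial_velocity \<gamma>" if \<gamma>: "\<gamma> \<in> \<Gamma>" for \<gamma>
  proof -
    obtain \<epsilon> where "0 < \<epsilon>" "\<And>t. 0 < t \<Longrightarrow> t < \<epsilon> \<Longrightarrow> f (\<gamma> 0) \<le> f (\<gamma> t)"
      using assms(7) \<gamma> by (metis greaterThanLessThan_iff)
    moreover have "(f has_derivative (\<lambda>h. grad_f xbar \<bullet> h)) (at xbar within C)"
      using assms(2,3) by (simp add: continuous_gradient_on_def)
    ultimately show ?thesis
      using assms(5) \<gamma> by (blast intro: inner_gradient_initial_velocity_nonneg)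
  qed
  \<comment> \<open>The cone equation rewrites the tangent vector \<open>d\<close> as a nonnegative
    combination of initial velocities.\<close>
  ultimately show "grad_f xbar \<bullet> d \<ge> 0"
    using inner_generated_cone_nonneg assms(6) by (smt (verit) mem_Collect_eq)
qed

end
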